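(* In the setting described in the context, let $\gamma\in(0,2\theta)$. For any dataset $\mathcal D\in\Xi^N$, any $i\in\{1,\dots,N\}$ and any dataset $\mathcal D^i$ obtained from $\mathcal D$ by replacing its $i$-th sample, the iterates $\hat x_K,\hat z_K$ generated from $\mathcal D$ and $\hat x_K^i,\hat z_K^i$ generated from $\mathcal D^i$ satisfy $$\|\hat x_K-\hat x_K^i\|\le\|\hat z_K-\hat z_K^i\|\le\frac{\gamma\varsigma K}{N},$$ whenever the initial points coincide, $\hat z_0=\hat z_0^i\in\mathbb R^n$.
   Context: Let $n,d,N\in\mathbb N$ with $N\ge1$, $K\in\mathbb N$, $\gamma>0$, $\theta>0$, $\varsigma>0$; $\mathbb R^n$ carries the Euclidean inner product and norm. $A,B:\mathbb R^n\rightrightarrows\mathbb R^n$ are maximally monotone set-valued operators and $C:\mathbb R^n\to\mathbb R^n$ is $\theta$-cocoercive, where a map $F:\mathbb R^n\to\mathbb R^n$ is $\theta$-cocoercive if $\langle x-y,F(x)-F(y)\rangle\ge\theta\|F(x)-F(y)\|^2$ for all $x,y$. It is assumed that $\operatorname{zer}(A+B+C)=\{x:0\in A(x)+B(x)+C(x)\}\neq\emptyset$. The resolvent of a maximally monotone $A$ is $J_{\gamma A}=(\mathrm{Id}+\gamma A)^{-1}$ (single-valued, defined on all of $\mathbb R^n$). Oracle: $\Xi\subseteq\mathbb R^d$ is a sample space with a probability distribution $\mathbb P$, and $O:\mathbb R^n\times\Xi\to\mathbb R^n$ satisfies: (i) $\mathbb E_{\xi\sim\mathbb P}[O(x,\xi)]=C(x)$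 for all $x$; (ii) $\|O(x,\xi)-O(x,\xi')\|\le\varsigma$ for all $x\in\mathbb R^n$, $\xi,\xi'\in\Xi$; (iii) $O(\cdot,\xi)$ is $\theta$-cocoercive for every $\xi\in\Xi$. For a dataset $\mathcal D=(\xi^1,\dots,\xi^N)\in\Xi^N$ put $\widehat C_{\mathcal D}(x)=\frac1N\sum_{j=1}^N O(x,\xi^j)$. From an initial point $\hat z_0\in\mathbb R^n$, the data-driven Davis–Yin iteration is $\hat x_t=J_{\gamma B}(\hat z_t)$, $\hat y_t=J_{\gamma A}(2\hat x_t-\hat z_t-\gamma\widehat C_{\mathcal D}(\hat x_t))$, $\hat z_{t+1}=\hat z_t+\hat y_t-\hat x_t$. For $i\in\{1,\dots,N\}$, $\mathcal D^i$ denotes a dataset obtained from $\mathcal D$ by replacing its $i$-th sample with an arbitrary $\tilde\xi^i\in\Xi$; $\hat x_t^i,\hat y_t^i,\hat z_t^i$ are the iterates of the same scheme run with $\mathcal D^i$ in place of $\mathcal D$ from the initial point $\hat z_0^i$. *)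

theory Defs
  imports "HOL-Probability.Probability"
begin

type_synonym 'a setop = "'a \<Rightarrow> 'a set"

definition monotone_op :: "'a::real_inner setop \<Rightarrow> bool" where
  "monotone_op A \<longleftrightarrow>
     (\<forall>x y. \<forall>u\<in>A x. \<forall>v\<in>A y. (x - y) \<bullet> (u - v) \<ge> 0)"

text \<open>Maximality is with respect to inclusion of graphs.\<close>

definition maximally_monotone :: "'a::real_inner setop \<Rightarrow> bool" where
  "maximally_monotone A \<longleftrightarrow>
     monotone_op A \<and>
     (\<forall>A'. monotone_op A' \<and> (\<forall>x. A x \<subseteq> A' x) \<longrightarrow> A' = A)"

definition cocoercive :: "real \<Rightarrow> ('a::real_inner \<Rightarrow> 'a) \<Rightarrow> bool" where
  "cocoercive \<theta> F \<longleftrightarrow>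
     (\<forall>x y. (x - y) \<bullet> (F x - F y) \<ge> \<theta> * (norm (F x - F y))\<^sup>2)"

definition op_add :: "'a::plus setop \<Rightarrow> 'a setop \<Rightarrow> 'a setop" where
  "op_add S T = (\<lambda>x. {s + t | s t. s \<in> S x \<and> t \<in> T x})"

definition op_scale :: "real \<Rightarrow> 'a::real_vector setop \<Rightarrow> 'a setop" where
  "op_scale c T = (\<lambda>x. {c *\<^sub>R t | t. t \<in> T x})"

definition op_of_fun :: "('a \<Rightarrow> 'a) \<Rightarrow> 'a setop" where
  "op_of_fun F = (\<lambda>x. {F x})"

definition op_inverse :: "'a setop \<Rightarrow> 'a setop" where
  "op_inverse T = (\<lambda>u. {x. u \<in> T x})"

definition zer :: "'a::zero setop \<Rightarrow> 'a set" where
  "zer T = {x. 0 \<in> T x}"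

text \<open>The inverse of Id + \<gamma> A, read as a function. The value is unspecified wherever that
  inverse is not single-valued; for \<gamma> > 0 and maximally monotone A it is single-valued
  everywhere, by Minty's theorem.\<close>

definition resolvent :: "real \<Rightarrow> 'a::real_vector setop \<Rightarrow> 'a \<Rightarrow> 'a" where
  "resolvent \<gamma> A u = the_elem (op_inverse (op_add (op_of_fun id) (op_scale \<gamma> A)) u)"

text \<open>A dataset of size N is a function on {1..N}, so the index starts at 1.\<close>

definition empirical_mean ::
    "('a::real_vector \<Rightarrow> 'b \<Rightarrow> 'a) \<Rightarrow> nat \<Rightarrow> (nat \<Rightarrow> 'b) \<Rightarrow> 'a \<Rightarrow> 'a" where
  "empirical_mean Orc N D x = (1 / real N) *\<^sub>R (\<Sum>j = 1..N. Orc x (D j))"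

definition dy_x_step :: "real \<Rightarrow> 'a::real_vector setop \<Rightarrow> 'a \<Rightarrow> 'a" where
  "dy_x_step \<gamma> B z = resolvent \<gamma> B z"

definition dy_y_step ::
    "real \<Rightarrow> 'a::real_vector setop \<Rightarrow> ('a \<Rightarrow> 'a) \<Rightarrow> 'a \<Rightarrow> 'a \<Rightarrow> 'a" where
  "dy_y_step \<gamma> A F x z = resolvent \<gamma> A (2 *\<^sub>R x - z - \<gamma> *\<^sub>R F x)"

primrec dy_z ::
    "real \<Rightarrow> 'a::real_vector setop \<Rightarrow> 'a setop \<Rightarrow> ('a \<Rightarrow> 'a) \<Rightarrow> 'a \<Rightarrow> nat \<Rightarrow> 'a" where
  "dy_z \<gamma> A B F z0 0 = z0"
| "dy_z \<gamma> A B F z0 (Suc t) =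
     (let z = dy_z \<gamma> A B F z0 t;
          x = dy_x_step \<gamma> B z;
          y = dy_y_step \<gamma> A F x z
      in z + y - x)"

definition dy_x ::
    "real \<Rightarrow> 'a::real_vector setop \<Rightarrow> 'a setop \<Rightarrow> ('a \<Rightarrow> 'a) \<Rightarrow> 'a \<Rightarrow> nat \<Rightarrow> 'a" where
  "dy_x \<gamma> A B F z0 t = dy_x_step \<gamma> B (dy_z \<gamma> A B F z0 t)"

end

theory Submission imports Defs begin

text \<open>
  Writing \<open>b = w - \<gamma> u\<close> for \<open>u \<in> A a\<close>, a point \<open>x\<close> solves \<open>w \<in> x + \<gamma> A x\<close> as soon as it
  lies in all the balls \<open>(x - a) \<bullet> (b - x) \<ge> 0\<close>; by compactness finitely many balls suffice, and
  for those \<open>x\<close> is found by minimizing \<open>\<parallel>(a + b) / 2\<parallel>\<^sup>2 - c\<close> over the convex hull of the triples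
  \<open>(a, b, a \<bullet> b)\<close>. So the resolvents are everywhere defined and firmly nonexpansive.

  One Davis--Yin step with a cocoercive map and \<open>\<gamma> \<le> 2 \<theta>\<close> is then nonexpansive, and replacing one
  sample moves the result of a step by at most \<open>\<gamma> \<sigma> / N\<close>. These errors add up over the \<open>K\<close> steps.
\<close>

section \<open>Common points of families of balls\<close>

text \<open>
  The condition defining \<open>\<phi>\<close> is affine in each of the two triples, so it passes from the points to
  their hull one triple at a time; then take both triples equal.
\<close>

lemma hull_le_inner:
  fixes S :: "('a::real_inner \<times> 'a) set"
  assumes mono: "\<And>a b a' b'. (a, b) \<in> S \<Longrightarrow> (a', b') \<in> S \<Longrightarrow> (a - a') \<bullet> (b - b') \<le> 0"
    and h: "(a, b, c) \<in> convex hull ((\<lambda>(a, b). (a, b, a \<bullet> b)) ` S)" (is "_ \<in> convex hull ?T")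
  shows "c \<le> a \<bullet> b"
proof -
  define \<phi> where "\<phi> a' b' c' = {(a, b, c). c - a \<bullet> b' - a' \<bullet> b + c' \<le> 0}"
    for a' b' :: 'a and c' :: real
  have cvx: "convex (\<phi> a' b' c')" for a' b' c'
  proof -
    have "\<phi> a' b' c' = {z. (- b', - a', 1) \<bullet> z \<le> - c'}"
      by (auto simp: \<phi>_def inner_prod_def inner_commute)
    then show ?thesis by (simp add: convex_halfspace_le)
  qed
  have 1: "convex hull ?T \<subseteq> \<phi> a' b' (a' \<bullet> b')" if "(a', b') \<in> S" for a' b'
  proof (rule hull_minimal)
    show "convex (\<phi> a' b' (a' \<bullet> b'))" by (rule cvx)
    show "?T \<subseteq> \<phi> a' b' (a' \<bullet> b')"
    proof clarify
      fix a b assume "(a, b) \<in> S"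
      from mono[OF this that] show "(a, b, a \<bullet> b) \<in> \<phi> a' b' (a' \<bullet> b')"
        by (simp add: \<phi>_def inner_diff)
    qed
  qed
  have "convex hull ?T \<subseteq> \<phi> a b c"
  proof (rule hull_minimal)
    show "convex (\<phi> a b c)" by (rule cvx)
    show "?T \<subseteq> \<phi> a b c"
      using 1 h by (force simp: \<phi>_def inner_commute algebra_simps)
  qed
  then show ?thesis using h by (auto simp: \<phi>_def inner_commute)
qed

text \<open>At the minimizer \<open>m\<close> of \<open>g\<close>, first-order optimality towards a
  vertex \<open>(a, b, a \<bullet> b)\<close> bounds \<open>a \<bullet> b - s m\<close> by
  \<open>x \<bullet> a + x \<bullet> b - 2 * (x \<bullet> x)\<close>. With
  \<open>s m \<le> x \<bullet> x\<close>, which comes from \<open>hull_le_inner\<close>, this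
  rearranges to \<open>(x - a) \<bullet> (b - x) \<ge> 0\<close>.\<close>

lemma finite_balls_common_point:
  fixes S :: "('a::euclidean_space \<times> 'a) set"
  assumes fin: "finite S"
    and mono: "\<And>a b a' b'. (a, b) \<in> S \<Longrightarrow> (a', b') \<in> S \<Longrightarrow> (a - a') \<bullet> (b - b') \<le> 0"
  shows "\<exists>x. \<forall>(a, b)\<in>S. (x - a) \<bullet> (b - x) \<ge> 0"
proof (cases "S = {}")
  case False
  define H where "H = convex hull ((\<lambda>(a, b). (a, b, a \<bullet> b)) ` S)"
  define p where "p = (\<lambda>z::'a \<times> 'a \<times> real. (1 / 2) *\<^sub>R (fst z + fst (snd z)))"
  define s where "s = (\<lambda>z::'a \<times> 'a \<times> real. snd (snd z))"
  define g where "g = (\<lambda>z. (norm (p z))\<^sup>2 - s z)"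
  have "compact H" "H \<noteq> {}"
    using fin False by (auto simp: H_def finite_imp_compact_convex_hull)
  moreover have "continuous_on H g"
    unfolding g_def p_def s_def by (intro continuous_intros)
  ultimately obtain m where m: "m \<in> H" "\<And>z. z \<in> H \<Longrightarrow> g m \<le> g z"
    using continuous_attains_inf[of H g] by blast
  define x where "x = p m"
  have sx: "s m \<le> (norm x)\<^sup>2"
  proof -
    obtain a b c where abc: "m = (a, b, c)" by (cases m) auto
    have "c \<le> a \<bullet> b"
      using hull_le_inner[OF mono] m(1) unfolding abc H_def by blast
    also have "a \<bullet> b = (norm x)\<^sup>2 - (norm ((1 / 2) *\<^sub>R (a - b)))\<^sup>2"
      unfolding x_def p_def abc power2_norm_eq_inner
      by (simp add: inner_commute algebra_simps)
    also have "\<dots> \<le> (norm x)\<^sup>2" by simp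
    finally show ?thesis by (simp add: abc s_def)
  qed
  \<comment> \<open>Compare \<open>g m\<close> with \<open>g\<close> a fraction \<open>t\<close>
    along the segment from \<open>m\<close> to \<open>z\<close>. After division by \<open>t\<close>
    the quadratic remainder is \<open>t * r\<close>, which the slack \<open>e\<close>
    absorbs.\<close>
  have first_order: "s z - s m \<le> 2 * (x \<bullet> (p z - x))" if "z \<in> H" for z
  proof (rule field_le_epsilon)
    fix e :: real assume e: "e > 0"
    define v where "v = p z - x"
    define r where "r = (norm v)\<^sup>2"
    \<comment> \<open>The bound 1 keeps the point on the segment; the other gives
      \<open>t * r \<le> e\<close>, with \<open>r + 1\<close> as denominator because
      \<open>r\<close> may vanish.\<close>
    define t where "t = min 1 (e / (r + 1))"
    have r: "r \<ge> 0" by (simp add: r_def)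
    have t: "0 < t" "t \<le> 1" using e r by (auto simp: t_def)
    have "t * r \<le> (e / (r + 1)) * r" using r by (intro mult_right_mono) (auto simp: t_def)
    also have "\<dots> \<le> e" using e r by (simp add: field_simps)
    finally have tr: "t * r \<le> e" .
    have "(1 - t) *\<^sub>R m + t *\<^sub>R z \<in> H"
      using t m(1) that unfolding H_def by (intro convexD[OF convex_convex_hull]) auto
    then have "g m \<le> g ((1 - t) *\<^sub>R m + t *\<^sub>R z)" by (rule m(2))
    moreover have "p ((1 - t) *\<^sub>R m + t *\<^sub>R z) = x + t *\<^sub>R v"
      unfolding v_def x_def p_def by (simp add: algebra_simps)
    moreover have "s ((1 - t) *\<^sub>R m + t *\<^sub>R z) = s m + t * (s z - s m)"
      unfolding s_def by (simp add: algebra_simps)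
    ultimately have "(norm x)\<^sup>2 - s m \<le> (norm (x + t *\<^sub>R v))\<^sup>2 - (s m + t * (s z - s m))"
      by (simp add: g_def flip: x_def)
    moreover have "(norm (x + t *\<^sub>R v))\<^sup>2 = (norm x)\<^sup>2 + 2 * t * (x \<bullet> v) + t\<^sup>2 * r"
      unfolding r_def power2_norm_eq_inner
      by (simp add: inner_add inner_commute power2_eq_square)
    ultimately have "t * (s z - s m) \<le> t * (2 * (x \<bullet> v) + t * r)"
      by (simp add: algebra_simps power2_eq_square)
    then have "s z - s m \<le> 2 * (x \<bullet> v) + t * r"
      using t by simp
    then show "s z - s m \<le> 2 * (x \<bullet> (p z - x)) + e" using tr by (simp add: v_def)
  qed
  have "(x - a) \<bullet> (b - x) \<ge> 0" if "(a, b) \<in> S" for a b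
  proof -
    have "(a, b, a \<bullet> b) \<in> H"
      unfolding H_def using that by (intro hull_inc) force
    from first_order[OF this] have "a \<bullet> b - s m \<le> x \<bullet> a + x \<bullet> b - 2 * (x \<bullet> x)"
      by (simp add: s_def p_def inner_add inner_diff add_divide_distrib)
    with sx show ?thesis
      by (simp add: power2_norm_eq_inner inner_diff inner_commute)
  qed
  then show ?thesis by blast
qed simp

text \<open>Completing the square about the midpoint. Compactness of these balls is what carries the
  finite case over to infinite families.\<close>

lemma diameter_ball:
  fixes a b :: "'a::real_inner"
  shows "{x. (x - a) \<bullet> (b - x) \<ge> 0} = cball ((1 / 2) *\<^sub>R (a + b)) (norm (a - b) / 2)"
proof -
  have "(x - a) \<bullet> (b - x) = (norm (a - b) / 2)\<^sup>2 - (dist ((1 / 2) *\<^sub>R (a + b)) x)\<^sup>2" for x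
    unfolding dist_norm power_divide power2_norm_eq_inner
    by (simp add: inner_add inner_diff inner_commute field_simps)
  then show ?thesis by (auto simp: abs_le_square_iff[symmetric])
qed

lemma balls_common_point:
  fixes S :: "('a::euclidean_space \<times> 'a) set"
  assumes mono: "\<And>a b a' b'. (a, b) \<in> S \<Longrightarrow> (a', b') \<in> S \<Longrightarrow> (a - a') \<bullet> (b - b') \<le> 0"
  shows "\<exists>x. \<forall>(a, b)\<in>S. (x - a) \<bullet> (b - x) \<ge> 0"
proof (cases "S = {}")
  case False
  then obtain s0 where s0: "s0 \<in> S" by blast
  define G where "G s = {x. (x - fst s) \<bullet> (snd s - x) \<ge> 0}" for s :: "'a \<times> 'a"
  have compact_G: "compact (G s)" for s by (simp add: G_def diameter_ball)
  \<comment> \<open>The finite intersection property is used inside the compact ball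
    \<open>G s0\<close>, so \<open>s0\<close> is adjoined to each finite subfamily
    \<open>I\<close>.\<close>
  have "G s0 \<inter> \<Inter>(G ` S) \<noteq> {}"
  proof (rule compact_imp_fip_image)
    show "compact (G s0)" by (rule compact_G)
    show "\<And>s. s \<in> S \<Longrightarrow> closed (G s)" using compact_G compact_imp_closed by blast
    fix I assume I: "finite I" "I \<subseteq> S"
    have "\<exists>x. \<forall>(a, b)\<in>insert s0 I. (x - a) \<bullet> (b - x) \<ge> 0"
      using I s0 mono by (intro finite_balls_common_point) blast+
    then show "G s0 \<inter> \<Inter>(G ` I) \<noteq> {}" by (force simp: G_def)
  qed
  then show ?thesis by (force simp: G_def)
qed simp

section \<open>Minty's theorem and resolvents\<close>

text \<open>For a common point \<open>x\<close> of the balls and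
  \<open>v = (1 / \<gamma>) *\<^sub>R (w - x)\<close>, the ball inequalities say, up to the factor
  \<gamma>, that \<open>(x, v)\<close> is monotonically related to the whole graph of
  \<open>A\<close>. Adding this pair keeps \<open>A\<close> monotone, so by maximality it was
  already there.\<close>

theorem Minty:
  fixes A :: "'a::euclidean_space setop"
  assumes A: "maximally_monotone A" and \<gamma>: "\<gamma> > 0"
  shows "\<exists>x. \<exists>u\<in>A x. w = x + \<gamma> *\<^sub>R u"
proof -
  define S where "S = {(a, w - \<gamma> *\<^sub>R u) |a u. u \<in> A a}"
  have mono: "(x - y) \<bullet> (u - v) \<ge> 0" if "u \<in> A x" "v \<in> A y" for x y u v
    using A that by (auto simp: maximally_monotone_def monotone_op_def)
  have "\<exists>x. \<forall>(a, b)\<in>S. (x - a) \<bullet> (b - x) \<ge> 0"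
  proof (rule balls_common_point)
    fix a b a' b' assume ab: "(a, b) \<in> S" "(a', b') \<in> S"
    obtain u where u: "u \<in> A a" "b = w - \<gamma> *\<^sub>R u"
      using ab(1) by (auto simp: S_def)
    obtain u' where u': "u' \<in> A a'" "b' = w - \<gamma> *\<^sub>R u'"
      using ab(2) by (auto simp: S_def)
    have "b - b' = - (\<gamma> *\<^sub>R (u - u'))" by (simp add: u(2) u'(2) algebra_simps)
    then show "(a - a') \<bullet> (b - b') \<le> 0"
      using mono[OF u(1) u'(1)] \<gamma> by simp
  qed
  then obtain x where x: "\<forall>(a, b)\<in>S. (x - a) \<bullet> (b - x) \<ge> 0" ..
  define v where "v = (1 / \<gamma>) *\<^sub>R (w - x)"
  have w: "w = x + \<gamma> *\<^sub>R v" using \<gamma> by (simp add: v_def)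
  have xv: "(x - a) \<bullet> (v - u) \<ge> 0" if "u \<in> A a" for a u
  proof -
    have "(x - a) \<bullet> (w - \<gamma> *\<^sub>R u - x) \<ge> 0" using bspec[OF x, of "(a, w - \<gamma> *\<^sub>R u)"] that by (auto simp: S_def)
    also have "w - \<gamma> *\<^sub>R u - x = \<gamma> *\<^sub>R (v - u)" by (simp add: w algebra_simps)
    finally show ?thesis using \<gamma> by (simp add: zero_le_mult_iff)
  qed
  have vx: "(a - x) \<bullet> (u - v) \<ge> 0" if "u \<in> A a" for a u
    using xv[OF that] by (simp add: inner_diff)
  define A' where "A' = A(x := insert v (A x))"
  have "monotone_op A'"
    unfolding monotone_op_def A'_def using mono xv vx by auto
  moreover have "\<forall>y. A y \<subseteq> A' y" by (auto simp: A'_def)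
  ultimately have "A' = A" using A by (auto simp: maximally_monotone_def)
  then have "v \<in> A x" using fun_upd_same[of A x] unfolding A'_def by (metis insertI1)
  then show ?thesis using w by blast
qed

text \<open>Minty's theorem gives a solution. Two solutions satisfy
  \<open>y - x = - (\<gamma> *\<^sub>R (v - u))\<close>, so monotonicity forces
  \<open>v = u\<close>; hence \<open>the_elem\<close> is applied to a singleton.\<close>

lemma resolvent_inclusion:
  fixes A :: "'a::euclidean_space setop"
  assumes A: "maximally_monotone A" and \<gamma>: "\<gamma> > 0"
  shows "\<exists>u\<in>A (resolvent \<gamma> A w). w = resolvent \<gamma> A w + \<gamma> *\<^sub>R u"
proof -
  obtain x u where x: "u \<in> A x" "w = x + \<gamma> *\<^sub>R u" using Minty[OF A \<gamma>] by blast
  have "y = x" if y: "v \<in> A y" "w = y + \<gamma> *\<^sub>R v" for y v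
  proof -
    have "(y - x) \<bullet> (v - u) \<ge> 0"
      using A x(1) y(1) by (auto simp: maximally_monotone_def monotone_op_def)
    moreover have "y - x = - (\<gamma> *\<^sub>R (v - u))"
      using x(2) y(2) by (simp add: algebra_simps)
    ultimately have "(v - u) \<bullet> (v - u) \<le> 0"
      using \<gamma> by (simp add: mult_le_0_iff)
    then have "v = u"
      using inner_ge_zero[of "v - u"] by (metis antisym eq_iff_diff_eq_0 inner_eq_zero_iff)
    then show ?thesis using x(2) y(2) by simp
  qed
  then have "op_inverse (op_add (op_of_fun id) (op_scale \<gamma> A)) w = {x}"
    using x by (auto simp: op_inverse_def op_add_def op_of_fun_def op_scale_def)
  then have "resolvent \<gamma> A w = x" by (simp add: resolvent_def)
  then show ?thesis using x by blast
qed

text \<open>\<open>w - w'\<close> is \<open>J w - J w'\<close> plus \<gamma> times a difference of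
  values of \<open>A\<close>; monotonicity makes the inner product of the latter with
  \<open>J w - J w'\<close> nonnegative.\<close>

lemma resolvent_firmly_nonexpansive:
  fixes A :: "'a::euclidean_space setop"
  assumes A: "maximally_monotone A" and \<gamma>: "\<gamma> > 0"
  defines "J \<equiv> resolvent \<gamma> A"
  shows "(norm (J w - J w'))\<^sup>2 \<le> (J w - J w') \<bullet> (w - w')"
proof -
  obtain u where u: "u \<in> A (J w)" "w = J w + \<gamma> *\<^sub>R u"
    using resolvent_inclusion[OF A \<gamma>] unfolding J_def by blast
  obtain u' where u': "u' \<in> A (J w')" "w' = J w' + \<gamma> *\<^sub>R u'"
    using resolvent_inclusion[OF A \<gamma>] unfolding J_def by blast
  have "(J w - J w') \<bullet> (u - u') \<ge> 0"
    using A u(1) u'(1) by (auto simp: maximally_monotone_def monotone_op_def)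
  moreover have "w - w' = (J w - J w') + \<gamma> *\<^sub>R (u - u')"
    by (subst u(2), subst u'(2)) (simp add: algebra_simps)
  ultimately show ?thesis using \<gamma>
    by (simp add: power2_norm_eq_inner inner_add_right)
qed

lemma resolvent_nonexpansive:
  fixes A :: "'a::euclidean_space setop"
  assumes A: "maximally_monotone A" and \<gamma>: "\<gamma> > 0"
  shows "norm (resolvent \<gamma> A w - resolvent \<gamma> A w') \<le> norm (w - w')"
proof -
  let ?d = "resolvent \<gamma> A w - resolvent \<gamma> A w'"
  have "norm ?d * norm ?d \<le> ?d \<bullet> (w - w')"
    using resolvent_firmly_nonexpansive[OF A \<gamma>] by (simp add: power2_eq_square)
  also have "\<dots> \<le> norm ?d * norm (w - w')" by (rule norm_cauchy_schwarz)
  finally show ?thesis by (cases "?d = 0") auto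
qed

section \<open>A single Davis-Yin step\<close>

text \<open>The update as a map of \<open>z\<close> alone, so that steps with different
  \<open>F\<close> can be compared at the same point.\<close>

definition dy_step ::
    "real \<Rightarrow> 'a::real_vector setop \<Rightarrow> 'a setop \<Rightarrow> ('a \<Rightarrow> 'a) \<Rightarrow> 'a \<Rightarrow> 'a" where
  "dy_step \<gamma> A B F z = z + dy_y_step \<gamma> A F (dy_x_step \<gamma> B z) z - dy_x_step \<gamma> B z"

lemma dy_z_Suc: "dy_z \<gamma> A B F z0 (Suc t) = dy_step \<gamma> A B F (dy_z \<gamma> A B F z0 t)"
  by (simp add: dy_step_def Let_def)

text \<open>
  With \<open>e = dy - dx\<close>, the three monotonicity hypotheses bound \<open>\<parallel>dz\<parallel>\<^sup>2 - \<parallel>dz + e\<parallel>\<^sup>2\<close> from below by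
  the square \<open>\<parallel>e + \<gamma> f\<parallel>\<^sup>2\<close>.
\<close>

lemma dy_increment_nonexpansive:
  fixes dx dy dz f :: "'a::real_inner"
  assumes x: "(norm dx)\<^sup>2 \<le> dx \<bullet> dz"
    and y: "(norm dy)\<^sup>2 \<le> dy \<bullet> (2 *\<^sub>R dx - dz - \<gamma> *\<^sub>R f)"
    and f: "\<theta> * (norm f)\<^sup>2 \<le> dx \<bullet> f"
    and \<gamma>: "0 \<le> \<gamma>" "\<gamma> \<le> 2 * \<theta>"
  shows "norm (dz + dy - dx) \<le> norm dz"
proof -
  have "\<gamma> * (\<gamma> * (norm f)\<^sup>2) \<le> \<gamma> * (2 * (\<theta> * (norm f)\<^sup>2))"
    using \<gamma> mult_right_mono[of \<gamma> "2 * \<theta>" "(norm f)\<^sup>2"] by (intro mult_left_mono) auto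
  also have "\<dots> \<le> \<gamma> * (2 * (dx \<bullet> f))" using f \<gamma> by (intro mult_left_mono) auto
  finally have 1: "\<gamma> * (\<gamma> * (f \<bullet> f)) \<le> \<gamma> * (2 * (dx \<bullet> f))" by (simp add: power2_norm_eq_inner)
  have 2: "0 \<le> (dy - dx + \<gamma> *\<^sub>R f) \<bullet> (dy - dx + \<gamma> *\<^sub>R f)" by simp
  \<comment> \<open>Twice the sum of \<open>x\<close> and \<open>y\<close> bounds the decrease below
    by \<open>e \<bullet> e + 2 * \<gamma> * (f \<bullet> dy)\<close>, where
    \<open>e = dy - dx\<close>. Writing \<open>dy = e + dx\<close> and applying \<open>1\<close> to
    the \<open>dx\<close> part completes the square in \<open>2\<close>.\<close>
  have "(norm (dz + dy - dx))\<^sup>2 \<le> (norm dz)\<^sup>2"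
    using 1 2 x y unfolding power2_norm_eq_inner
    by (simp add: inner_add inner_diff inner_commute algebra_simps)
  then show ?thesis by (simp add: power2_le_iff_abs_le)
qed

lemma dy_step_nonexpansive:
  fixes A B :: "'a::euclidean_space setop"
  assumes A: "maximally_monotone A" and B: "maximally_monotone B"
    and F: "cocoercive \<theta> F" and \<gamma>: "0 < \<gamma>" "\<gamma> \<le> 2 * \<theta>"
  shows "norm (dy_step \<gamma> A B F z - dy_step \<gamma> A B F z') \<le> norm (z - z')"
proof -
  define x x' where "x = resolvent \<gamma> B z" and "x' = resolvent \<gamma> B z'"
  define y y' where "y = resolvent \<gamma> A (2 *\<^sub>R x - z - \<gamma> *\<^sub>R F x)"
    and "y' = resolvent \<gamma> A (2 *\<^sub>R x' - z' - \<gamma> *\<^sub>R F x')"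
  have "norm ((z - z') + (y - y') - (x - x')) \<le> norm (z - z')"
  proof (rule dy_increment_nonexpansive)
    show "(norm (x - x'))\<^sup>2 \<le> (x - x') \<bullet> (z - z')"
      unfolding x_def x'_def by (rule resolvent_firmly_nonexpansive[OF B \<gamma>(1)])
    have "(norm (y - y'))\<^sup>2 \<le>
      (y - y') \<bullet> ((2 *\<^sub>R x - z - \<gamma> *\<^sub>R F x) - (2 *\<^sub>R x' - z' - \<gamma> *\<^sub>R F x'))"
      unfolding y_def y'_def by (rule resolvent_firmly_nonexpansive[OF A \<gamma>(1)])
    then show "(norm (y - y'))\<^sup>2 \<le> (y - y') \<bullet> (2 *\<^sub>R (x - x') - (z - z') - \<gamma> *\<^sub>R (F x - F x'))"
      by (simp add: algebra_simps)
    show "\<theta> * (norm (F x - F x'))\<^sup>2 \<le> (x - x') \<bullet> (F x - F x')"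
      using F by (simp add: cocoercive_def)
  qed (use \<gamma> in auto)
  moreover have "(z - z') + (y - y') - (x - x')
      = dy_step \<gamma> A B F z - dy_step \<gamma> A B F z'"
    by (simp add: dy_step_def dy_x_step_def dy_y_step_def x_def x'_def y_def y'_def)
  ultimately show ?thesis by simp
qed

text \<open>The \<open>x\<close>-step does not involve the forward map, so only the argument of the
  resolvent of \<open>A\<close> changes, by \<gamma> times the difference of \<open>F\<close> and
  \<open>G\<close> at \<open>x\<close>.\<close>

lemma dy_step_perturbation:
  fixes A B :: "'a::euclidean_space setop"
  assumes A: "maximally_monotone A" and \<gamma>: "0 < \<gamma>"
    and close: "\<And>x. norm (F x - G x) \<le> \<delta>"
  shows "norm (dy_step \<gamma> A B F z - dy_step \<gamma> A B G z) \<le> \<gamma> * \<delta>"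
proof -
  define x where "x = dy_x_step \<gamma> B z"
  have "norm (dy_step \<gamma> A B F z - dy_step \<gamma> A B G z)
      = norm (dy_y_step \<gamma> A F x z - dy_y_step \<gamma> A G x z)"
    by (simp add: dy_step_def x_def)
  also have "\<dots> \<le> norm ((2 *\<^sub>R x - z - \<gamma> *\<^sub>R F x) - (2 *\<^sub>R x - z - \<gamma> *\<^sub>R G x))"
    unfolding dy_y_step_def by (rule resolvent_nonexpansive[OF A \<gamma>])
  also have "\<dots> = norm (\<gamma> *\<^sub>R (G x - F x))" by (simp add: algebra_simps)
  also have "\<dots> = \<gamma> * norm (F x - G x)" using \<gamma> by (simp add: norm_minus_commute)
  also have "\<dots> \<le> \<gamma> * \<delta>" using close \<gamma> by simp
  finally show ?thesis .
qed

section \<open>Error accumulation and empirical means\<close>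

lemma dy_z_stability:
  fixes A B :: "'a::euclidean_space setop"
  assumes A: "maximally_monotone A" and B: "maximally_monotone B"
    and F: "cocoercive \<theta> F" and \<gamma>: "0 < \<gamma>" "\<gamma> \<le> 2 * \<theta>"
    and close: "\<And>x. norm (F x - G x) \<le> \<delta>"
  shows "norm (dy_z \<gamma> A B F z0 t - dy_z \<gamma> A B G z0 t) \<le> real t * (\<gamma> * \<delta>)"
proof (induction t)
  case (Suc t)
  let ?z = "dy_z \<gamma> A B F z0 t" and ?w = "dy_z \<gamma> A B G z0 t"
  \<comment> \<open>Inserting the \<open>F\<close>-step from \<open>?w\<close> separates the
    inherited error, which nonexpansiveness does not enlarge, from the new error of one
    step.\<close>
  have "norm (dy_step \<gamma> A B F ?z - dy_step \<gamma> A B G ?w)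
      \<le> norm (dy_step \<gamma> A B F ?z - dy_step \<gamma> A B F ?w)
        + norm (dy_step \<gamma> A B F ?w - dy_step \<gamma> A B G ?w)"
    by (rule norm_diff_triangle_le[OF order_refl order_refl])
  also have "\<dots> \<le> real t * (\<gamma> * \<delta>) + \<gamma> * \<delta>"
    using Suc.IH dy_step_nonexpansive[OF A B F \<gamma>, of ?z ?w]
      dy_step_perturbation[where A = A and B = B and F = F and G = G, OF A \<gamma>(1) close]
    by (intro add_mono) (auto intro: order_trans)
  finally show ?case
    unfolding dy_z_Suc by (simp add: algebra_simps)
qed simp

text \<open>By Cauchy-Schwarz, the squared norm of a sum of \<open>N\<close> vectors is at most
  \<open>N\<close> times the sum of their squared norms. The weights \<open>1 / N\<close> cancel
  this factor, so \<theta> is preserved.\<close>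

lemma cocoercive_empirical_mean:
  fixes Orc :: "'a::real_inner \<Rightarrow> 'b \<Rightarrow> 'a"
  assumes N: "N \<ge> 1" and \<theta>: "\<theta> \<ge> 0"
    and coco: "\<And>j. j \<in> {1..N} \<Longrightarrow> cocoercive \<theta> (\<lambda>x. Orc x (D j))"
  shows "cocoercive \<theta> (empirical_mean Orc N D)"
  unfolding cocoercive_def
proof (intro allI)
  fix x y
  define f where "f j = Orc x (D j) - Orc y (D j)" for j
  have d: "empirical_mean Orc N D x - empirical_mean Orc N D y = (1 / real N) *\<^sub>R (\<Sum>j = 1..N. f j)"
    by (simp add: empirical_mean_def f_def sum_subtractf algebra_simps)
  have "(norm (\<Sum>j = 1..N. f j))\<^sup>2 \<le> (\<Sum>j = 1..N. norm (f j))\<^sup>2"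
    by (intro power_mono norm_sum) auto
  also have "\<dots> \<le> (\<Sum>j = 1..N. (norm (f j))\<^sup>2) * real N"
    using sum_squared_le_sum_of_squares[of "\<lambda>j. norm (f j)" "{1..N}"] by simp
  finally have "\<theta> * (norm (\<Sum>j = 1..N. f j))\<^sup>2 \<le> \<theta> * ((\<Sum>j = 1..N. (norm (f j))\<^sup>2) * real N)"
    using \<theta> by (rule mult_left_mono)
  also have "\<dots> = (\<Sum>j = 1..N. \<theta> * (norm (f j))\<^sup>2) * real N"
    by (simp add: sum_distrib_left)
  also have "\<dots> \<le> (\<Sum>j = 1..N. (x - y) \<bullet> f j) * real N"
    using coco by (intro mult_right_mono sum_mono) (auto simp: cocoercive_def f_def)
  finally have "\<theta> * (norm (\<Sum>j = 1..N. f j))\<^sup>2 \<le> ((x - y) \<bullet> (\<Sum>j = 1..N. f j)) * real N"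
    by (simp add: inner_sum_right)
  then show "\<theta> * (norm (empirical_mean Orc N D x - empirical_mean Orc N D y))\<^sup>2
      \<le> (x - y) \<bullet> (empirical_mean Orc N D x - empirical_mean Orc N D y)"
    unfolding d using N by (simp add: field_simps power2_eq_square)
qed

lemma empirical_mean_replace:
  fixes Orc :: "'a::real_normed_vector \<Rightarrow> 'b \<Rightarrow> 'a"
  assumes i: "i \<in> {1..N}"
  shows "empirical_mean Orc N D x - empirical_mean Orc N (D(i := \<xi>)) x
      = (1 / real N) *\<^sub>R (Orc x (D i) - Orc x \<xi>)"
proof -
  have "(\<Sum>j = 1..N. Orc x (D j)) - (\<Sum>j = 1..N. Orc x ((D(i := \<xi>)) j))
      = (\<Sum>j = 1..N. if j = i then Orc x (D i) - Orc x \<xi> else 0)"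
    unfolding sum_subtractf[symmetric] by (rule sum.cong) auto
  also have "\<dots> = Orc x (D i) - Orc x \<xi>" using i by simp
  finally show ?thesis
    unfolding empirical_mean_def scaleR_diff_right[symmetric] by simp
qed

theorem proposition2:
  fixes A B :: "real ^ 'n \<Rightarrow> (real ^ 'n) set"
    and C :: "real ^ 'n \<Rightarrow> real ^ 'n"
    and \<Xi> :: "(real ^ 'd) set"
    and P :: "(real ^ 'd) measure"
    and Orc :: "real ^ 'n \<Rightarrow> real ^ 'd \<Rightarrow> real ^ 'n"
    and \<gamma> \<theta> \<sigma> :: real
    and N K i :: nat
    and D :: "nat \<Rightarrow> real ^ 'd"
    and \<xi>' :: "real ^ 'd"
    and z0 z0i :: "real ^ 'n"
  assumes "N \<ge> 1" and "\<theta> > 0" and "\<sigma> > 0"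
    and "maximally_monotone A" and "maximally_monotone B"
    and "cocoercive \<theta> C"
    and "zer (op_add (op_add A B) (op_of_fun C)) \<noteq> {}"
    and "prob_space P" and "space P = \<Xi>"
    and "\<And>x. has_bochner_integral P (\<lambda>\<xi>. Orc x \<xi>) (C x)"
    and "\<And>x \<xi> \<xi>'. \<xi> \<in> \<Xi> \<Longrightarrow> \<xi>' \<in> \<Xi> \<Longrightarrow> norm (Orc x \<xi> - Orc x \<xi>') \<le> \<sigma>"
    and "\<And>\<xi>. \<xi> \<in> \<Xi> \<Longrightarrow> cocoercive \<theta> (\<lambda>x. Orc x \<xi>)"
    and "0 < \<gamma>" and "\<gamma> < 2 * \<theta>"
    and "D \<in> {1..N} \<rightarrow>\<^sub>E \<Xi>"
    and "i \<in> {1..N}" and "\<xi>' \<in> \<Xi>"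
    and "z0 = z0i"
  shows "let F = empirical_mean Orc N D;
             Fi = empirical_mean Orc N (D(i := \<xi>'));
             x = dy_x \<gamma> A B F z0 K; xi = dy_x \<gamma> A B Fi z0i K;
             z = dy_z \<gamma> A B F z0 K; zi = dy_z \<gamma> A B Fi z0i K
         in norm (x - xi) \<le> norm (z - zi) \<and>
            norm (z - zi) \<le> \<gamma> * \<sigma> * real K / real N"
proof -
  define F where "F = empirical_mean Orc N D"
  define G where "G = empirical_mean Orc N (D(i := \<xi>'))"
  have mem: "D j \<in> \<Xi>" if "j \<in> {1..N}" for j
    using \<open>D \<in> {1..N} \<rightarrow>\<^sub>E \<Xi>\<close> that by (rule PiE_mem)
  have coco: "cocoercive \<theta> F"
    unfolding F_def using assms(1,2,12) mem by (intro cocoercive_empirical_mean) auto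
  \<comment> \<open>Only the summand with index \<open>i\<close> changes, by at most \<sigma>, and
    it carries the weight \<open>1 / real N\<close>.\<close>
  have close: "norm (F x - G x) \<le> \<sigma> / real N" for x
    using assms(11)[OF mem[OF \<open>i \<in> {1..N}\<close>] \<open>\<xi>' \<in> \<Xi>\<close>, of x] \<open>N \<ge> 1\<close>
    unfolding F_def G_def empirical_mean_replace[OF \<open>i \<in> {1..N}\<close>]
    by (simp add: divide_right_mono)
  have "norm (dy_z \<gamma> A B F z0 K - dy_z \<gamma> A B G z0 K) \<le> real K * (\<gamma> * (\<sigma> / real N))"
    using assms(4,5,13,14) coco close by (intro dy_z_stability[where \<theta> = \<theta>]) auto
  then have "norm (dy_z \<gamma> A B F z0 K - dy_z \<gamma> A B G z0 K) \<le> \<gamma> * \<sigma> * real K / real N"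
    by (simp add: algebra_simps)
  moreover have "norm (dy_x \<gamma> A B F z0 K - dy_x \<gamma> A B G z0 K)
      \<le> norm (dy_z \<gamma> A B F z0 K - dy_z \<gamma> A B G z0 K)"
    unfolding dy_x_def dy_x_step_def
    using assms(5,13) by (rule resolvent_nonexpansive)
  ultimately show ?thesis
    unfolding Let_def \<open>z0 = z0i\<close> F_def G_def by simp
qed

end
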